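(* Let $m,n$ be positive integers with $m\equiv 2\pmod 4$ and $n\equiv 2\pmod 4$. Then there exists a cyclic and $\phi_n$-symmetric hamiltonian cycle system of $K_{m\times n}$.
   Context: $K_{m\times n}$ is the complete multipartite graph with $m$ parts of size $n$, with vertex set identified with $\mathbb{Z}_{mn}$, parts the cosets of $m\mathbb{Z}_{mn}$, and $x,y$ adjacent iff $x-y\notin m\mathbb{Z}_{mn}$. A hamiltonian cycle system is a set of hamiltonian cycles whose edge sets partition the edge set; it is cyclic if it is closed under adding $1$ to all vertices of a cycle. $\phi_n$ is the map $x\mapsto x+m$ on $\mathbb{Z}_{mn}$; the system is $\phi_n$-symmetric if each of its cycles is mapped to itself by $\phi_n$. *)

theory Defs
  imports "HOL-Library.Disjoint_Sets" "HOL-Number_Theory.Cong"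
begin

text \<open>
  A simple graph is given by a vertex set and a set of two-element sets of vertices (its edges).
  A hamiltonian cycle is a spanning subgraph, so it is identified with its edge set; in
  particular neither the starting vertex nor the direction of traversal matters.
\<close>

definition cycle_edges :: "'a list \<Rightarrow> 'a set set" where
  "cycle_edges xs = {{xs ! i, xs ! (Suc i mod length xs)} | i. i < length xs}"

definition hamiltonian_cycle :: "'a set \<Rightarrow> 'a set set \<Rightarrow> 'a set set \<Rightarrow> bool" where
  "hamiltonian_cycle V E C \<longleftrightarrow>
     (\<exists>xs. length xs \<ge> 3 \<and> distinct xs \<and> set xs = V \<and> C = cycle_edges xs) \<and> C \<subseteq> E"

definition hamiltonian_cycle_system :: "'a set \<Rightarrow> 'a set set \<Rightarrow> 'a set set set \<Rightarrow> bool" where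
  "hamiltonian_cycle_system V E \<C> \<longleftrightarrow>
     (\<forall>C\<in>\<C>. hamiltonian_cycle V E C) \<and> partition_on E \<C>"

definition map_edges :: "('a \<Rightarrow> 'b) \<Rightarrow> 'a set set \<Rightarrow> 'b set set" where
  "map_edges f C = (\<lambda>e. f ` e) ` C"

text \<open>
  The group $\mathbb{Z}_N$ is represented by the residues $0, \dots, N-1$ with arithmetic
  modulo $N$.
\<close>

definition Zmod :: "nat \<Rightarrow> int set" where
  "Zmod N = {0..<int N}"

definition shift :: "nat \<Rightarrow> nat \<Rightarrow> int \<Rightarrow> int" where
  "shift N a x = (x + int a) mod int N"

definition multiples :: "nat \<Rightarrow> nat \<Rightarrow> int set" where
  "multiples N m = {(int m * k) mod int N | k. k \<in> Zmod N}"

definition Kmult_verts :: "nat \<Rightarrow> nat \<Rightarrow> int set" where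
  "Kmult_verts m n = Zmod (m * n)"

definition Kmult_edges :: "nat \<Rightarrow> nat \<Rightarrow> int set set" where
  "Kmult_edges m n =
     {{x, y} | x y. x \<in> Zmod (m * n) \<and> y \<in> Zmod (m * n) \<and>
        (x - y) mod int (m * n) \<notin> multiples (m * n) m}"

definition HCS_Kmult :: "nat \<Rightarrow> nat \<Rightarrow> int set set set \<Rightarrow> bool" where
  "HCS_Kmult m n \<C> \<longleftrightarrow> hamiltonian_cycle_system (Kmult_verts m n) (Kmult_edges m n) \<C>"

definition cyclic_system :: "nat \<Rightarrow> nat \<Rightarrow> int set set set \<Rightarrow> bool" where
  "cyclic_system m n \<C> \<longleftrightarrow> (\<forall>C\<in>\<C>. map_edges (shift (m * n) 1) C \<in> \<C>)"

definition phi :: "nat \<Rightarrow> nat \<Rightarrow> int \<Rightarrow> int" where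
  "phi m n = shift (m * n) m"

definition phi_symmetric :: "nat \<Rightarrow> nat \<Rightarrow> int set set set \<Rightarrow> bool" where
  "phi_symmetric m n \<C> \<longleftrightarrow> (\<forall>C\<in>\<C>. map_edges (phi m n) C = C)"

end

theory Submission
  imports Defs
begin

text \<open>
  Write $m = 2a$, $n = 2b$ with $a, b$ odd and $N = 4ab$. A sequence $c_0, \dots, c_{l-1}$ of
  representatives modulo a divisor $l$ of $N$, continued by $c_{j+l} = c_j + rl$ with $r$ a unit
  modulo $N/l$, traces a hamiltonian cycle invariant under $x \mapsto x + l$; its translates use
  exactly the edges whose difference is one of the steps $\pm(c_{j+1} - c_j)$. Hence it suffices
  to distribute the differences not divisible by $2a$, up to sign, among such sequences with
  $l \mid 2a$.

  For $l = 2$ take $0, 1 + 4s, 2$: its steps $1 \pm 4s$ dispose of all odd differences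
  $1 + 4s$ with $a \nmid s$. For $l = a > 1$ take, for $0 \le k < b$, a zigzag with steps
  $2(ak+1), -2(ak+2), 2(ak+3), \dots$ and closing condition $c_a = c_0 - a$. The $a - 1$ even
  steps of these $b$ sequences exhaust the even differences. In the last even step $k$ is replaced
  by $b - 1 - k$, so that the closing step is $-(1 + 4at)$ with $t$ running through all residues
  modulo $b$, which disposes of the remaining odd differences. For $a = 1$ only the first kind is
  needed, with all $s$.
\<close>

section \<open>Edge sets of cycles invariant under translation by \<open>l\<close>\<close>

text \<open>
  Only the values of $c$ at $0, \dots, l$ matter. The edge set is described by residues of the
  initial vertex of a step, so no order of traversal is involved.
\<close>

definition dcycle :: "int \<Rightarrow> nat \<Rightarrow> (nat \<Rightarrow> int) \<Rightarrow> int set set" where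
  "dcycle N l c =
     {{v mod N, (v + (c (Suc j) - c j)) mod N} | v j. j < l \<and> [v = c j] (mod int l)}"

text \<open>An edge sees only the class of its initial vertex modulo \<open>l\<close> and its step
  modulo \<open>N\<close>. Hence translations by multiples of \<open>l\<close> act
  trivially.\<close>

lemma dcycle_cong:
  assumes "\<And>j. j < l \<Longrightarrow> [c j = c' j] (mod int l)"
    and "\<And>j. j < l \<Longrightarrow> [c (Suc j) - c j = c' (Suc j) - c' j] (mod N)"
  shows "dcycle N l c = dcycle N l c'"
proof -
  have *: "dcycle N l f \<subseteq> dcycle N l g"
    if fg: "\<And>j. j < l \<Longrightarrow> [f j = g j] (mod int l)"
      "\<And>j. j < l \<Longrightarrow> [f (Suc j) - f j = g (Suc j) - g j] (mod N)" for f g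
  proof
    fix e assume "e \<in> dcycle N l f"
    then obtain v j where e: "e = {v mod N, (v + (f (Suc j) - f j)) mod N}" "j < l"
      "[v = f j] (mod int l)" unfolding dcycle_def by blast
    have "e = {v mod N, (v + (g (Suc j) - g j)) mod N}"
      using e fg(2)[OF e(2)] by (metis cong_add_lcancel cong_def)
    moreover have "[v = g j] (mod int l)" using e(3) fg(1)[OF e(2)] cong_trans by blast
    ultimately show "e \<in> dcycle N l g" unfolding dcycle_def using e(2) by blast
  qed
  show ?thesis
    using *[of c c'] *[of c' c] assms by (meson cong_sym subset_antisym)
qed

lemma dcycle_nonempty: "0 < l \<Longrightarrow> dcycle N l c \<noteq> {}"
  unfolding dcycle_def by (blast intro: cong_refl)

text \<open>A translation keeps every step and only moves initial vertices, so cyclicity and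
  symmetry become statements about the sequences \<open>c\<close>.\<close>

lemma map_edges_shift_dcycle:
  "map_edges (shift N t) (dcycle (int N) l c) = dcycle (int N) l (\<lambda>j. c j + int t)"
proof -
  have im: "shift N t ` {v mod int N, (v + d) mod int N}
      = {(v + int t) mod int N, (v + int t + d) mod int N}" for v d
    by (simp add: shift_def mod_add_left_eq) (simp add: add_ac)
  show ?thesis
  proof (intro equalityI subsetI)
    fix e assume "e \<in> map_edges (shift N t) (dcycle (int N) l c)"
    then obtain v j where vj: "j < l" "[v = c j] (mod int l)"
      "e = {(v + int t) mod int N, (v + int t + (c (Suc j) - c j)) mod int N}"
      unfolding map_edges_def dcycle_def using im by auto
    moreover have "[v + int t = c j + int t] (mod int l)"
      using vj(2) by (rule cong_add) simp
    ultimately show "e \<in> dcycle (int N) l (\<lambda>j. c j + int t)"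
      unfolding dcycle_def by auto
  next
    fix e assume "e \<in> dcycle (int N) l (\<lambda>j. c j + int t)"
    then obtain v j where vj: "j < l" "[v = c j + int t] (mod int l)"
      "e = {v mod int N, (v + (c (Suc j) - c j)) mod int N}"
      unfolding dcycle_def by auto
    have "[v - int t = c j] (mod int l)"
      using cong_diff[OF vj(2) cong_refl[of "int t"]] by simp
    moreover have "e = shift N t ` {(v - int t) mod int N,
        (v - int t + (c (Suc j) - c j)) mod int N}"
      unfolding im vj(3) by simp
    ultimately show "e \<in> map_edges (shift N t) (dcycle (int N) l c)"
      unfolding map_edges_def dcycle_def using vj(1) by blast
  qed
qed

lemma dcycle_hamiltonian:
  fixes c :: "nat \<Rightarrow> int" and r :: int
  assumes N: "N = l * L" "3 \<le> N" and r: "coprime r (int L)"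
    and close: "c l = c 0 + r * int l"
    and inj: "\<And>i j. i < l \<Longrightarrow> j < l \<Longrightarrow> [c i = c j] (mod int l) \<Longrightarrow> i = j"
  shows "\<exists>xs. length xs \<ge> 3 \<and> distinct xs \<and> set xs = Zmod N \<and> dcycle (int N) l c = cycle_edges xs"
proof -
  have l0: "l > 0" and L0: "L > 0" using N by (auto intro: Nat.gr0I)
  \<comment> \<open>This is the continuation of \<open>c\<close> beyond one period: each full period
    adds \<open>r * l\<close>. By \<open>close\<close>, the step across a period boundary is again a
    step of \<open>c\<close>.\<close>
  define x where "x p = c (p mod l) + r * int l * int (p div l)" for p
  define xs where "xs = map (\<lambda>p. x p mod int N) [0..<N]"
  have len: "length xs = N" by (simp add: xs_def)
  have xl: "[x p = c (p mod l)] (mod int l)" for p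
    unfolding x_def by (simp add: cong_iff_dvd_diff)
  have step: "x (Suc p) = x p + (c (Suc (p mod l)) - c (p mod l))" for p
  proof (cases "Suc (p mod l) = l")
    case True
    then have "Suc p mod l = 0" "Suc p div l = Suc (p div l)"
      by (simp_all add: mod_Suc div_Suc)
    then show ?thesis using True close by (simp add: x_def algebra_simps)
  next
    case False
    then have "Suc p mod l = Suc (p mod l)" "Suc p div l = p div l"
      by (simp_all add: mod_Suc div_Suc)
    then show ?thesis by (simp add: x_def)
  qed
  have injx: "p = q" if pq: "p < N" "q < N" "[x p = x q] (mod int N)" for p q
  proof -
    have "[x p = x q] (mod int l)"
      using pq(3) N(1) by (metis cong_modulus_mult of_nat_mult)
    then have "[c (p mod l) = c (q mod l)] (mod int l)"
      using xl cong_sym cong_trans by metis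
    \<comment> \<open>The position within the period is now recovered. What remains is a multiple of
      \<open>l\<close>; cancelling \<open>l\<close> and the unit \<open>r\<close> recovers the
      number of periods.\<close>
    then have m: "p mod l = q mod l" using inj l0 by simp
    have "int l * int L dvd int l * (r * (int (p div l) - int (q div l)))"
      using pq(3) m N(1) by (simp add: cong_iff_dvd_diff x_def algebra_simps)
    then have "int L dvd r * (int (p div l) - int (q div l))" using l0 by simp
    then have "int L dvd int (p div l) - int (q div l)"
      using r by (simp add: coprime_commute coprime_dvd_mult_right_iff)
    then have "[p div l = q div l] (mod L)"
      by (simp add: cong_iff_dvd_diff flip: cong_int_iff)
    moreover have "p div l < L" "q div l < L"
      using pq N(1) by (simp_all add: less_mult_imp_div_less mult.commute)
    ultimately have "p div l = q div l" by (simp add: cong_def)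
    then show ?thesis using m by (metis div_mult_mod_eq)
  qed
  have dist: "distinct xs"
    unfolding xs_def distinct_map by (auto intro!: inj_onI injx simp: cong_def)
  have "set xs \<subseteq> Zmod N" using N(2) by (auto simp: xs_def Zmod_def)
  then have sx: "set xs = Zmod N"
    using distinct_card[OF dist] len by (intro card_subset_eq) (auto simp: Zmod_def)
  \<comment> \<open>After \<open>N = l * L\<close> steps the total displacement is
    \<open>r * l * L\<close>, a multiple of \<open>N\<close>, so the walk closes up.\<close>
  have xN: "x N mod int N = x 0 mod int N"
    using N(1) l0 by (simp add: x_def mult.commute mult.left_commute)
  have nxt: "xs ! (Suc p mod length xs) = x (Suc p) mod int N" if "p < N" for p
    using that xN N(2) by (cases "Suc p = N") (auto simp: xs_def)
  have ce: "cycle_edges xs = {{x p mod int N, x (Suc p) mod int N} | p. p < N}"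
  proof -
    have "{xs ! p, xs ! (Suc p mod length xs)} = {x p mod int N, x (Suc p) mod int N}"
      if "p < N" for p
      using that nxt[OF that] by (simp add: xs_def)
    then show ?thesis unfolding cycle_edges_def len by (metis (no_types, lifting))
  qed
  have "dcycle (int N) l c = cycle_edges xs"
  proof (intro equalityI subsetI)
    fix e assume "e \<in> dcycle (int N) l c"
    then obtain v j where vj: "j < l" "[v = c j] (mod int l)"
      "e = {v mod int N, (v + (c (Suc j) - c j)) mod int N}"
      unfolding dcycle_def by auto
    \<comment> \<open>The walk visits every vertex, so it visits \<open>v\<close> at some time
      \<open>p\<close>; injectivity modulo \<open>l\<close> forces \<open>p mod l = j\<close>, and
      the step taken there is the prescribed one.\<close>
    have "v mod int N \<in> set xs" using N(2) by (simp add: sx Zmod_def)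
    then obtain p where p: "p < N" "v mod int N = x p mod int N"
      by (auto simp: xs_def)
    then have "[v = x p] (mod int l)"
      using N(1) by (metis cong_modulus_mult of_nat_mult cong_def)
    then have "[c (p mod l) = c j] (mod int l)"
      using xl vj(2) cong_sym cong_trans by metis
    then have "p mod l = j" using inj vj(1) l0 by simp
    then have "e = {x p mod int N, x (Suc p) mod int N}"
      using vj(3) p(2) step[of p] by (metis mod_add_left_eq)
    then show "e \<in> cycle_edges xs" using p(1) ce by blast
  next
    fix e assume "e \<in> cycle_edges xs"
    then obtain p where "p < N" "e = {x p mod int N, x (Suc p) mod int N}" using ce by blast
    then have "e = {x p mod int N, (x p + (c (Suc (p mod l)) - c (p mod l))) mod int N}"
      by (simp only: step)
    moreover have "p mod l < l" using l0 by simp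
    ultimately show "e \<in> dcycle (int N) l c" unfolding dcycle_def using xl[of p] by blast
  qed
  then show ?thesis using len N(2) dist sx by blast
qed

section \<open>Edges and their differences\<close>

text \<open>Two descriptions of an edge have the same orientation or opposite ones; reversal swaps
  the endpoints and negates the difference.\<close>

lemma edge_eq_mod:
  fixes N :: int
  assumes "{v mod N, (v + d) mod N} = {v' mod N, (v' + d') mod N}"
  shows "([v = v'] (mod N) \<and> [d = d'] (mod N)) \<or> ([v = v' + d'] (mod N) \<and> [d = - d'] (mod N))"
proof -
  consider "[v = v'] (mod N)" "[v + d = v' + d'] (mod N)"
    | "[v = v' + d'] (mod N)" "[v + d = v'] (mod N)"
    using assms by (auto simp: doubleton_eq_iff cong_def)
  then show ?thesis
  proof cases
    case 1
    then show ?thesis using cong_diff[OF 1(2,1)] by simp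
  next
    case 2
    then show ?thesis using cong_diff[OF 2(2,1)] by simp
  qed
qed

text \<open>Since \<open>m\<close> divides \<open>m * n\<close>, reduction modulo
  \<open>m * n\<close> does not affect divisibility by \<open>m\<close>. Adjacency can thus be
  tested on arbitrary integer representatives.\<close>

lemma Kmult_edges_iff:
  assumes "m > 0" "n > 0"
  shows "{x mod int (m * n), y mod int (m * n)} \<in> Kmult_edges m n \<longleftrightarrow> \<not> int m dvd y - x"
proof -
  let ?N = "int (m * n)"
  have N: "?N > 0" using assms by simp
  have mult: "z mod ?N \<in> multiples (m * n) m \<longleftrightarrow> int m dvd z" for z
  proof
    assume "z mod ?N \<in> multiples (m * n) m"
    then obtain k where "z mod ?N = (int m * k) mod ?N" unfolding multiples_def by blast
    then have "?N dvd z - int m * k" by (simp only: mod_eq_dvd_iff)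
    then have "int m dvd z - int m * k" by (metis dvd_mult_left of_nat_mult)
    then show "int m dvd z" by (simp add: dvd_diff_right_iff dvd_diff_left_iff)
  next
    assume "int m dvd z"
    then obtain k where k: "z = int m * k" by blast
    have "z mod ?N = (int m * (k mod ?N)) mod ?N" by (simp add: k mod_mult_right_eq)
    moreover have "k mod ?N \<in> Zmod (m * n)" using N by (simp add: Zmod_def)
    ultimately show "z mod ?N \<in> multiples (m * n) m" unfolding multiples_def by blast
  qed
  have diff: "(p mod ?N - q mod ?N) mod ?N = (p - q) mod ?N" for p q by (simp add: mod_diff_eq)
  have Z: "z mod ?N \<in> Zmod (m * n)" for z using N by (simp add: Zmod_def)
  show ?thesis
  proof
    assume "{x mod ?N, y mod ?N} \<in> Kmult_edges m n"
    then obtain p q where pq: "{x mod ?N, y mod ?N} = {p, q}"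
      "(p - q) mod ?N \<notin> multiples (m * n) m" unfolding Kmult_edges_def by blast
    then consider "p = x mod ?N" "q = y mod ?N" | "p = y mod ?N" "q = x mod ?N"
      by (auto simp: doubleton_eq_iff)
    then show "\<not> int m dvd y - x"
      using pq(2) mult diff by cases (auto simp: dvd_diff_commute)
  next
    assume "\<not> int m dvd y - x"
    then have "(x mod ?N - y mod ?N) mod ?N \<notin> multiples (m * n) m"
      by (simp only: mult diff dvd_diff_commute not_False_eq_True)
    then show "{x mod ?N, y mod ?N} \<in> Kmult_edges m n"
      unfolding Kmult_edges_def using Z by blast
  qed
qed

section \<open>The two kinds of sequences\<close>

text \<open>Adding a multiple of 4 at odd places keeps the value congruent to \<open>j\<close>
  modulo 2, and the value 2 at \<open>j = 2\<close> meets the closing condition with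
  \<open>r = 1\<close>.\<close>

definition alt :: "int \<Rightarrow> nat \<Rightarrow> int" where
  "alt s j = int j + (if odd j then 4 * s else 0)"

text \<open>
  The value at $a - 1$ is chosen so that the step leading to it equals
  $-2(a(b-1-k) + a - 1)$ modulo $4ab$.
\<close>

definition zig :: "nat \<Rightarrow> nat \<Rightarrow> int \<Rightarrow> int \<Rightarrow> nat \<Rightarrow> int" where
  "zig a b k u j = u +
     (if j \<ge> a then - int a
      else if Suc j = a then 4 * int a * k + 2 * int a * int b + int a + 1
      else if odd j then 2 * int a * k + int j + 1
      else - int j)"

text \<open>The offset \<open>u\<close> cancels in differences, so steps are taken at
  \<open>u = 0\<close>.\<close>

definition zstep :: "nat \<Rightarrow> nat \<Rightarrow> int \<Rightarrow> nat \<Rightarrow> int" where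
  "zstep a b k j = zig a b k 0 (Suc j) - zig a b k 0 j"

text \<open>Up to sign and modulo $4ab$, half of an even step of the zigzag.\<close>

definition zhalf :: "nat \<Rightarrow> nat \<Rightarrow> int \<Rightarrow> nat \<Rightarrow> int" where
  "zhalf a b k j = int a * (if Suc (Suc j) = a then int b - 1 - k else k) + int j + 1"

text \<open>The explicit factor 4 lets parities and residues modulo 4 be read off from a congruence
  modulo \<open>N\<close>.\<close>

lemma cong_4E:
  fixes x y P :: int
  assumes "[x = y] (mod 4 * P)"
  obtains q where "x = y + 4 * (P * q)"
  using assms by (metis cong_iff_lin cong_sym mult.assoc)

lemma cong_2_iff: "[x = y] (mod 2) \<longleftrightarrow> even x = even (y :: int)"
  by (simp add: cong_iff_dvd_diff)

section \<open>Cycles with \<open>l = 2\<close>\<close>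

text \<open>The position in the period is the parity of \<open>v\<close> relative to
  \<open>u\<close>, which eliminates the index: the steps are \<open>1 + 4 * s\<close> at position 0
  and \<open>1 - 4 * s\<close> at position 1.\<close>

lemma mem_dcycle_alt_shift:
  "e \<in> dcycle N 2 (\<lambda>j. alt s j + u) \<longleftrightarrow>
     (\<exists>v. e = {v mod N, (v + (1 + 4 * (if even v = even u then s else - s))) mod N})"
proof
  assume "e \<in> dcycle N 2 (\<lambda>j. alt s j + u)"
  then obtain v j where vj: "j < 2" "[v = alt s j + u] (mod 2)"
    "e = {v mod N, (v + (alt s (Suc j) - alt s j)) mod N}"
    unfolding dcycle_def by auto
  from vj(1) consider "j = 0" | "j = 1" by linarith
  then have "alt s (Suc j) - alt s j = 1 + 4 * (if even v = even u then s else - s)"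
    using vj(2) by cases (auto simp: alt_def cong_2_iff)
  with vj(3) show "\<exists>v. e = {v mod N, (v + (1 + 4 * (if even v = even u then s else - s))) mod N}"
    by metis
next
  assume "\<exists>v. e = {v mod N, (v + (1 + 4 * (if even v = even u then s else - s))) mod N}"
  then obtain v where e: "e = {v mod N, (v + (1 + 4 * (if even v = even u then s else - s))) mod N}" ..
  define j :: nat where "j = (if even v = even u then 0 else 1)"
  have "[v = alt s j + u] (mod int 2)"
    by (auto simp: j_def alt_def cong_2_iff)
  moreover have "e = {v mod N, (v + (alt s (Suc j) + u - (alt s j + u))) mod N}"
    by (simp add: e j_def alt_def)
  moreover have "j < 2" by (simp add: j_def)
  ultimately show "e \<in> dcycle N 2 (\<lambda>j. alt s j + u)" unfolding dcycle_def by blast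
qed

lemma mem_dcycle_alt:
  "e \<in> dcycle N 2 (alt s) \<longleftrightarrow>
     (\<exists>v. e = {v mod N, (v + (1 + 4 * (if even v then s else - s))) mod N})"
  using mem_dcycle_alt_shift[of e N s 0] by simp

lemma dcycle_alt_cong:
  assumes "[s = s'] (mod P)"
  shows "dcycle (4 * P) 2 (alt s) = dcycle (4 * P) 2 (alt s')"
proof -
  have "[4 * s = 4 * s'] (mod 4 * P)" using assms by (simp add: cong_def)
  then have "[v + (1 + 4 * (if even v then s else - s)) = v + (1 + 4 * (if even v then s' else - s'))]
      (mod 4 * P)" for v
    by (cases "even v") (auto simp: cong_iff_dvd_diff dvd_diff_commute)
  then show ?thesis unfolding set_eq_iff mem_dcycle_alt cong_def by simp
qed

text \<open>Translation by 1 exchanges the parity classes and thereby the two steps, which amounts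
  to negating \<open>s\<close>.\<close>

lemma dcycle_alt_add_1: "dcycle N 2 (\<lambda>j. alt s j + 1) = dcycle N 2 (alt (- s))"
proof -
  have "(if even v = even (1 :: int) then s else - s) = (if even v then - s else - (- s))" for v :: int
    by simp
  then show ?thesis by (intro set_eqI) (simp only: mem_dcycle_alt_shift mem_dcycle_alt)
qed

lemma dcycle_alt_hamiltonian:
  assumes "L > 1"
  shows "\<exists>xs. length xs \<ge> 3 \<and> distinct xs \<and> set xs = Zmod (2 * L) \<and>
    dcycle (int (2 * L)) 2 (alt s) = cycle_edges xs"
proof (rule dcycle_hamiltonian[where L = L and r = 1])
  fix i j :: nat assume ij: "i < 2" "j < 2" "[alt s i = alt s j] (mod int 2)"
  then have "[int i = int j] (mod 2)" by (auto simp: alt_def cong_iff_dvd_diff split: if_splits)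
  then have "[i = j] (mod 2)" using cong_int_iff[of i j 2] by simp
  then show "i = j" using ij by (simp add: cong_def)
qed (use assms in \<open>auto simp: alt_def\<close>)

section \<open>Zigzag cycles with \<open>l = a\<close>\<close>

lemma mem_dcycle_zig:
  "e \<in> dcycle N a (zig a b k u) \<longleftrightarrow>
     (\<exists>v j. j < a \<and> [v = u + zig a b k 0 j] (mod int a) \<and>
        e = {v mod N, (v + zstep a b k j) mod N})"
  unfolding dcycle_def zstep_def zig_def by auto

lemma dcycle_zig_cong:
  assumes "[u = u'] (mod int a)"
  shows "dcycle N a (zig a b k u) = dcycle N a (zig a b k u')"
proof (rule dcycle_cong)
  show "[zig a b k u j = zig a b k u' j] (mod int a)" for j
    unfolding zig_def using assms by (intro cong_add cong_refl)
qed (simp add: zig_def)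

text \<open>Modulo \<open>a\<close> the multiples of \<open>a\<close> vanish, and the exceptional
  value at \<open>a - 1\<close> reduces to 1, as does the regular value \<open>- (a - 1)\<close>. So
  the pattern 0, 2, -2, 4, -4, ... is unbroken.\<close>

lemma zig_cong:
  assumes "odd a" "j < a"
  shows "[zig a b k u j = u + (if odd j then int j + 1 else - int j)] (mod int a)"
proof -
  have "even j" if "Suc j = a" using that assms by auto
  moreover have "int a dvd 4 * int a * k + 2 * int a * int b + int a + 1 + int j" if "Suc j = a"
  proof -
    have "4 * int a * k + 2 * int a * int b + int a + 1 + int j = int a * (4 * k + 2 * int b + 2)"
      unfolding that[symmetric] by (simp add: algebra_simps)
    then show ?thesis by simp
  qed
  ultimately show ?thesis
    using assms unfolding zig_def by (simp add: cong_iff_dvd_diff)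
qed

lemma dcycle_zig_hamiltonian:
  assumes "odd a" "a > 1" "L > 2"
  shows "\<exists>xs. length xs \<ge> 3 \<and> distinct xs \<and> set xs = Zmod (a * L) \<and>
    dcycle (int (a * L)) a (zig a b k u) = cycle_edges xs"
proof (rule dcycle_hamiltonian[where L = L and r = "- 1"])
  have "1 * L \<le> a * L" using assms(2) by (intro mult_le_mono1) simp
  then show "3 \<le> a * L" using assms(3) by linarith
  fix i j :: nat assume ij: "i < a" "j < a" "[zig a b k u i = zig a b k u j] (mod int a)"
  define f where "f j = (if odd j then int j + 1 else - int j)" for j :: nat
  have "[u + f i = u + f j] (mod int a)"
    using ij zig_cong[OF assms(1)] unfolding f_def by (metis cong_sym cong_trans)
  then have d: "int a dvd f i - f j" by (simp add: cong_iff_dvd_diff)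
  \<comment> \<open>The number \<open>p + q + 1\<close> is a positive even multiple of the odd
    number \<open>a\<close>, hence at least \<open>2 * a\<close>, whereas \<open>p, q < a\<close>
    bounds it by \<open>2 * a - 1\<close>.\<close>
  have mix: False if "odd p" "even q" "p < a" "q < a" "int a dvd int p + 1 + int q" for p q :: nat
  proof -
    have "a dvd p + q + 1"
      using that(5) int_dvd_int_iff[of a "p + q + 1"] by (simp add: add_ac)
    then obtain t where t: "p + q + 1 = a * t" by blast
    have "even (a * t)" using that(1,2) t by (metis even_add odd_one)
    then have "even t" using assms(1) by simp
    moreover have "t \<noteq> 0" using t by (intro notI) simp
    ultimately have "2 \<le> t" by (auto elim!: evenE)
    then have "a * 2 \<le> a * t" by simp
    then have "p = a - 1" "q = a - 1" using t that(3,4) by linarith+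
    then show False using that(1,2) by simp
  qed
  have close: "i = j" if "int a dvd int i - int j"
  proof -
    have "[i = j] (mod a)" using that cong_int_iff[of i j a] by (simp add: cong_iff_dvd_diff)
    then show ?thesis using ij by (simp add: cong_def)
  qed
  show "i = j"
  proof (cases "odd i"; cases "odd j")
    assume "odd i" "odd j" then show ?thesis using d close by (simp add: f_def)
  next
    assume "odd i" "\<not> odd j" then show ?thesis
      using d mix[of i j] ij by (simp add: f_def)
  next
    assume p: "\<not> odd i" "odd j"
    then have "f i - f j = - (int j + 1 + int i)" by (simp add: f_def)
    then have "int a dvd - (int j + 1 + int i)" using d by simp
    then have "int a dvd int j + 1 + int i" by (simp only: dvd_minus_iff)
    then show ?thesis using p mix[of j i] ij by simp
  next
    assume "\<not> odd i" "\<not> odd j"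
    then have "int a dvd - (int i - int j)" using d by (simp add: f_def)
    then show ?thesis using close by (simp only: dvd_minus_iff)
  qed
qed (use assms in \<open>auto simp: zig_def\<close>)

section \<open>Steps of the zigzag\<close>

text \<open>Equality is exact except for the step into the exceptional value, at
  \<open>j = a - 2\<close>, where the two sides differ by \<open>4 * a * b\<close>.\<close>

lemma zstep_even:
  assumes "odd a" "Suc j < a"
  shows "[zstep a b k j = (if even j then 2 else - 2) * zhalf a b k j] (mod 4 * (int a * int b))"
proof (cases "Suc (Suc j) = a")
  case True
  then have "odd j" using assms(1) by auto
  then have "zstep a b k j - - 2 * zhalf a b k j = 4 * (int a * int b)"
    using True by (simp add: zstep_def zig_def zhalf_def flip: True) (simp add: algebra_simps)
  with \<open>odd j\<close> show ?thesis unfolding cong_iff_dvd_diff by simp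
next
  case False
  then have "Suc (Suc j) < a" using assms(2) by simp
  then have "zstep a b k j = (if even j then 2 else - 2) * zhalf a b k j"
    using False by (simp add: zstep_def zig_def zhalf_def algebra_simps)
  then show ?thesis by simp
qed

text \<open>The closing step is \<open>- (1 + 4 * a * k + 2 * a * (b + 1))\<close>, and
  \<open>b + 1\<close> is even. As \<open>k\<close> runs modulo \<open>b\<close>, so does the
  cofactor of \<open>4 * a\<close>.\<close>

lemma zstep_odd:
  assumes "odd b" "Suc j = a" "a > 1"
  shows "zstep a b k j = - (1 + 4 * (int a * (k + (int b + 1) div 2)))"
proof -
  obtain c where c: "b = 2 * c + 1" using assms(1) by (rule oddE)
  then have "(int b + 1) div 2 = int c + 1" by simp
  then show ?thesis using assms(2,3) c by (simp add: zstep_def zig_def algebra_simps)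
qed

text \<open>The formula is a division by \<open>a\<close> with quotient in \<open>0..b - 1\<close>,
  a range preserved by the reflection \<open>b - 1 - k\<close>, and with nonzero remainder
  \<open>j + 1\<close>.\<close>

lemma zhalf_bounds:
  assumes "0 \<le> k" "k < int b" "Suc j < a"
  shows "0 < zhalf a b k j" "zhalf a b k j < int a * int b" "\<not> int a dvd zhalf a b k j"
proof -
  define t where "t = (if Suc (Suc j) = a then int b - 1 - k else k)"
  have t: "0 \<le> t" "t \<le> int b - 1" using assms by (auto simp: t_def)
  have z: "zhalf a b k j = int a * t + int (Suc j)" by (simp add: zhalf_def t_def)
  have "0 \<le> int a * t" using t by simp
  then show "0 < zhalf a b k j" unfolding z by linarith
  have "int a * t \<le> int a * (int b - 1)" using t by (intro mult_left_mono) auto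
  then show "zhalf a b k j < int a * int b" unfolding z using assms(3) by (simp add: algebra_simps)
  have "\<not> a dvd Suc j" using assms(3) nat_dvd_not_less by blast
  then show "\<not> int a dvd zhalf a b k j"
    unfolding z by (simp only: dvd_add_right_iff[OF dvd_triv_left] int_dvd_int_iff) simp
qed

text \<open>The remainder modulo \<open>a\<close> recovers \<open>j\<close>; for fixed
  \<open>j\<close> the quotient is \<open>k\<close> or its reflection, either of which determines
  \<open>k\<close>.\<close>

lemma zhalf_inj:
  assumes "Suc j < a" "Suc j' < a" "zhalf a b k j = zhalf a b k' j'"
  shows "j = j'" "k = k'"
proof -
  have md: "zhalf a b k j mod int a = int (Suc j)" if "Suc j < a" for k j
  proof -
    have "zhalf a b k j = int (Suc j) + int a * (if Suc (Suc j) = a then int b - 1 - k else k)"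
      by (simp add: zhalf_def)
    then show ?thesis using that by (simp only: mod_mult_self2) simp
  qed
  show j: "j = j'" using md[OF assms(1), of k] md[OF assms(2), of k'] assms(3) by simp
  then show "k = k'" using assms by (auto simp: zhalf_def split: if_splits)
qed

section \<open>Each edge lies in at most one cycle\<close>

lemma alt_unique:
  assumes "e \<in> dcycle (4 * P) 2 (alt s)" "e \<in> dcycle (4 * P) 2 (alt s')" 
  shows "dcycle (4 * P) 2 (alt s) = dcycle (4 * P) 2 (alt s')"
proof -
  define \<sigma> where "\<sigma> t v = (if even v then t else - t)" for t v :: int
  obtain v where v: "e = {v mod (4 * P), (v + (1 + 4 * \<sigma> s v)) mod (4 * P)}"
    using assms(1) unfolding mem_dcycle_alt \<sigma>_def by blast
  obtain v' where v': "e = {v' mod (4 * P), (v' + (1 + 4 * \<sigma> s' v')) mod (4 * P)}"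
    using assms(2) unfolding mem_dcycle_alt \<sigma>_def by blast
  consider "[v = v'] (mod 4 * P)" "[1 + 4 * \<sigma> s v = 1 + 4 * \<sigma> s' v'] (mod 4 * P)"
    | "[1 + 4 * \<sigma> s v = - (1 + 4 * \<sigma> s' v')] (mod 4 * P)"
    using edge_eq_mod v v' by metis
  then show ?thesis
  proof cases
    case 1
    obtain q where "v = v' + 4 * (P * q)" using cong_4E 1(1) by blast
    then have par: "even v = even v'" by simp
    obtain q' where q': "1 + 4 * \<sigma> s v = 1 + 4 * \<sigma> s' v' + 4 * (P * q')"
      using cong_4E 1(2) by blast
    then have "\<sigma> s v = \<sigma> s' v' + P * q'" by simp
    then have "s - s' = P * q' \<or> s - s' = P * - q'"
      using par unfolding \<sigma>_def by (cases "even v") simp_all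
    then have "P dvd s - s'" by (metis dvd_triv_left)
    then show ?thesis by (intro dcycle_alt_cong) (simp add: cong_iff_dvd_diff)
  next
    \<comment> \<open>Opposite orientations are impossible: the differences are 1 modulo 4, their
      negatives are 3.\<close>
    case 2
    then obtain q where "1 + 4 * \<sigma> s v = - (1 + 4 * \<sigma> s' v') + 4 * (P * q)" using cong_4E by blast
    then show ?thesis by presburger
  qed
qed

lemma zstep_parity:
  assumes "odd a" "odd b" "a > 1" "j < a"
  shows "even (zstep a b k j) \<longleftrightarrow> Suc j < a"
proof (cases "Suc j < a")
  case True
  obtain q where "zstep a b k j = (if even j then 2 else - 2) * zhalf a b k j
      + 4 * (int a * int b * q)"
    using zstep_even[OF assms(1) True] cong_4E by blast
  then show ?thesis using True by simp
next
  case False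
  then have "Suc j = a" using assms(4) by simp
  then show ?thesis using zstep_odd[OF assms(2) _ assms(3)] by simp
qed

text \<open>All values lie strictly between 0 and \<open>a * b\<close>. A sum of two is therefore no
  multiple of \<open>2 * a * b\<close>, and a difference is one only if it vanishes.\<close>

lemma zhalf_cong:
  assumes k: "0 \<le> k" "k < int b" "Suc j < a" and k': "0 \<le> k'" "k' < int b" "Suc j' < a"
    and e: "\<bar>\<epsilon>\<bar> = 1"
    and c: "[zhalf a b k j = \<epsilon> * zhalf a b k' j'] (mod 2 * (int a * int b))"
  shows "\<epsilon> = 1" "j = j'" "k = k'"
proof -
  let ?P = "int a * int b"
  note z = zhalf_bounds[OF k] and z' = zhalf_bounds[OF k']
  have d: "2 * ?P dvd zhalf a b k j - \<epsilon> * zhalf a b k' j'"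
    using c by (simp only: cong_iff_dvd_diff)
  show e1: "\<epsilon> = 1"
  proof (rule ccontr)
    assume "\<epsilon> \<noteq> 1"
    then have "\<epsilon> = - 1" using e by linarith
    then have "2 * ?P dvd zhalf a b k j + zhalf a b k' j'" using d by simp
    then have "2 * ?P \<le> zhalf a b k j + zhalf a b k' j'" by (rule zdvd_imp_le) (use z z' in linarith)
    then show False using z z' by linarith
  qed
  have "\<bar>zhalf a b k j - zhalf a b k' j'\<bar> < 2 * ?P" using z z' by linarith
  then have "zhalf a b k j = zhalf a b k' j'"
    using d e1 dvd_imp_le_int[of "zhalf a b k j - zhalf a b k' j'" "2 * ?P"] by fastforce
  then show "j = j'" "k = k'" using zhalf_inj k(3) k'(3) by blast+
qed

text \<open>Parity separates the closing step from the others. Even steps are halved and compared by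
  \<open>zhalf_cong\<close>; closing steps are compared modulo 4 for the sign and modulo
  \<open>b\<close> for \<open>k\<close>.\<close>

lemma zstep_unique:
  assumes ab: "odd a" "odd b" "a > 1"
    and k: "0 \<le> k" "k < int b" "j < a" and k': "0 \<le> k'" "k' < int b" "j' < a"
    and e: "\<bar>\<epsilon>\<bar> = 1"
    and c: "[zstep a b k j = \<epsilon> * zstep a b k' j'] (mod 4 * (int a * int b))"
  shows "\<epsilon> = 1 \<and> j = j' \<and> k = k'"
proof -
  let ?P = "int a * int b"
  have par: "Suc j < a \<longleftrightarrow> Suc j' < a"
  proof -
    obtain q where "zstep a b k j = \<epsilon> * zstep a b k' j' + 4 * (?P * q)" using cong_4E c by blast
    moreover have "odd \<epsilon>" using e by (cases "\<epsilon> < 0") auto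
    ultimately have "even (zstep a b k j) = even (zstep a b k' j')" by simp
    then show ?thesis using zstep_parity[OF ab k(3)] zstep_parity[OF ab k'(3)] by simp
  qed
  show ?thesis
  proof (cases "Suc j < a")
    case True
    then have True': "Suc j' < a" using par by simp
    define s where "s j = (if even j then 1 else - 1 :: int)" for j :: nat
    have s: "\<bar>s i\<bar> = 1" "s i * s i = 1" for i by (auto simp: s_def)
    have zs: "[zstep a b k i = 2 * (s i * zhalf a b k i)] (mod 4 * ?P)" if "Suc i < a" for k i
      using zstep_even[OF ab(1) that, of b k] by (simp add: s_def split: if_splits)
    have "[2 * (s j * zhalf a b k j) = \<epsilon> * (2 * (s j' * zhalf a b k' j'))] (mod 4 * ?P)"
      using zs[OF True, of k] cong_scalar_left[OF zs[OF True', of k'], of \<epsilon>] c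
      by (meson cong_sym cong_trans)
    then have "2 * (2 * ?P) dvd 2 * (s j * zhalf a b k j - \<epsilon> * (s j' * zhalf a b k' j'))"
      by (simp add: cong_iff_dvd_diff algebra_simps)
    then have "2 * ?P dvd s j * zhalf a b k j - \<epsilon> * (s j' * zhalf a b k' j')"
      by (rule dvd_mult_cancel_left[THEN iffD1, THEN disjE]) auto
    then have "2 * ?P dvd s j * (s j * zhalf a b k j - \<epsilon> * (s j' * zhalf a b k' j'))"
      by (rule dvd_mult)
    moreover have "s j * (s j * zhalf a b k j - \<epsilon> * (s j' * zhalf a b k' j'))
        = (s j * s j) * zhalf a b k j - (s j * \<epsilon> * s j') * zhalf a b k' j'"
      by (simp only: algebra_simps)
    ultimately have *: "[zhalf a b k j = (s j * \<epsilon> * s j') * zhalf a b k' j'] (mod 2 * ?P)"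
      unfolding cong_iff_dvd_diff s by simp
    have "\<bar>s j * \<epsilon> * s j'\<bar> = 1" using s e by (simp add: abs_mult)
    \<comment> \<open>This yields \<open>s j * \<epsilon> * s j' = 1\<close> together with
      \<open>j = j'\<close>, so the squares \<open>s j * s j\<close> drop out and
      \<open>\<epsilon> = 1\<close>.\<close>
    note h = zhalf_cong[OF k(1,2) True k'(1,2) True' this *]
    then show ?thesis using s by (simp add: mult.commute mult.left_commute)
  next
    case False
    then have j: "Suc j = a" "Suc j' = a" using par k(3) k'(3) by auto
    define t where "t k = k + (int b + 1) div 2" for k
    have zs: "zstep a b k i = - (1 + 4 * (int a * t k))" if "Suc i = a" for k i
      unfolding t_def by (rule zstep_odd[OF ab(2) that ab(3)])
    obtain q where q: "- (1 + 4 * (int a * t k)) = \<epsilon> * - (1 + 4 * (int a * t k')) + 4 * (?P * q)"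
      using cong_4E c unfolding zs[OF j(1)] zs[OF j(2)] by blast
    have e1: "\<epsilon> = 1"
    proof (rule ccontr)
      assume "\<epsilon> \<noteq> 1"
      then have "\<epsilon> = - 1" using e by linarith
      then have "- (1 + 4 * (int a * t k)) = 1 + 4 * (int a * t k') + 4 * (?P * q)" using q by simp
      then show False by presburger
    qed
    then have "int a * t k' = int a * t k + ?P * q" using q by simp
    then have "int a * t k' = int a * (t k + int b * q)" by (simp add: algebra_simps)
    then have "t k' = t k + int b * q" using ab(3) by simp
    then have "[k' = k] (mod int b)" by (simp add: t_def cong_iff_dvd_diff)
    then have "k' = k" using k k' by (simp add: cong_def)
    then show ?thesis using e1 j by simp
  qed
qed

text \<open>The step at a common edge fixes \<open>k\<close>, \<open>j\<close> and the orientation;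
  the initial vertex, known modulo \<open>a\<close>, then fixes \<open>u\<close> modulo
  \<open>a\<close>, which determines the cycle.\<close>

lemma zig_unique:
  assumes ab: "odd a" "odd b" "a > 1"
    and k: "0 \<le> k" "k < int b" and k': "0 \<le> k'" "k' < int b"
    and N: "N = 4 * (int a * int b)"
    and e: "e \<in> dcycle N a (zig a b k u)" "e \<in> dcycle N a (zig a b k' u')"
  shows "dcycle N a (zig a b k u) = dcycle N a (zig a b k' u')"
proof -
  obtain v j where v: "j < a" "[v = u + zig a b k 0 j] (mod int a)"
      "e = {v mod N, (v + zstep a b k j) mod N}"
    using e(1) unfolding mem_dcycle_zig by blast
  obtain v' j' where v': "j' < a" "[v' = u' + zig a b k' 0 j'] (mod int a)"
      "e = {v' mod N, (v' + zstep a b k' j') mod N}"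
    using e(2) unfolding mem_dcycle_zig by blast
  note uniq = zstep_unique[OF ab k v(1) k' v'(1), folded N]
  consider "[v = v'] (mod N)" "[zstep a b k j = 1 * zstep a b k' j'] (mod N)"
    | "[zstep a b k j = - 1 * zstep a b k' j'] (mod N)"
    using edge_eq_mod v(3) v'(3) by (metis mult_1 mult_minus_left)
  then show ?thesis
  proof cases
    case 1
    then have jk: "j = j'" "k = k'" using uniq[of 1] by simp_all
    have "[v = v'] (mod int a)" using 1(1) N by (metis cong_modulus_mult mult.assoc mult.commute)
    then have "[u + zig a b k 0 j = u' + zig a b k 0 j] (mod int a)"
      using v(2) v'(2) jk by (metis cong_sym cong_trans)
    then have "[u = u'] (mod int a)" by (simp add: cong_add_rcancel)
    then show ?thesis using dcycle_zig_cong jk by blast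
  next
    case 2
    then show ?thesis using uniq[of "- 1"] by simp
  qed
qed

lemma alt_zig_disjoint:
  assumes ab: "odd a" "odd b" "a > 1"
    and s: "\<not> int a dvd s"
    and N: "N = 4 * (int a * int b)"
    and e: "e \<in> dcycle N 2 (alt s)" "e \<in> dcycle N a (zig a b k u)"
  shows False
proof -
  obtain v where "e = {v mod N, (v + (1 + 4 * (if even v then s else - s))) mod N}"
    using e(1) unfolding mem_dcycle_alt by blast
  moreover define s' where "s' = (if even v then s else - s)"
  ultimately have v: "e = {v mod N, (v + (1 + 4 * s')) mod N}" by simp
  have s': "\<not> int a dvd s'" using s by (simp add: s'_def)
  obtain v' j where v': "j < a" "e = {v' mod N, (v' + zstep a b k j) mod N}"
    using e(2) unfolding mem_dcycle_zig by blast
  have "[1 + 4 * s' = zstep a b k j] (mod N) \<or> [1 + 4 * s' = - zstep a b k j] (mod N)"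
    using edge_eq_mod v v'(2) by metis
  then obtain q where q: "1 + 4 * s' = zstep a b k j + 4 * (int a * int b * q) \<or>
      1 + 4 * s' = - zstep a b k j + 4 * (int a * int b * q)"
    unfolding N using cong_4E by metis
  \<comment> \<open>An odd zigzag step is a closing step, which is -1 modulo 4. So the edge is
    traversed in opposite directions, and comparing the differences makes \<open>s'\<close>
    divisible by \<open>a\<close>.\<close>
  then have "odd (zstep a b k j)" by presburger
  then have "Suc j = a" using zstep_parity[OF ab v'(1)] v'(1) by simp
  then obtain t where t: "zstep a b k j = - (1 + 4 * (int a * t))"
    using zstep_odd[OF ab(2) _ ab(3)] by blast
  have "\<not> 1 + 4 * s' = zstep a b k j + 4 * (int a * int b * q)" unfolding t by presburger
  then have "s' = int a * t + int a * int b * q" using q t by simp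
  then have "s' = int a * (t + int b * q)" by (simp add: algebra_simps)
  then show False using s' by simp
qed

section \<open>Each admissible edge lies in some cycle\<close>

text \<open>The offset is free, so it can place the chosen initial vertex at position
  \<open>j\<close>; for \<open>\<epsilon> = - 1\<close> the edge is started from its other
  end.\<close>

lemma zig_cover:
  assumes "j < a" "\<epsilon> = 1 \<or> \<epsilon> = - 1" "[y - x = \<epsilon> * zstep a b k j] (mod N)"
  shows "\<exists>u. {x mod N, y mod N} \<in> dcycle N a (zig a b k u)"
proof -
  have *: "{p mod N, q mod N} \<in> dcycle N a (zig a b k (p - zig a b k 0 j))"
    if "[q - p = zstep a b k j] (mod N)" for p q
  proof -
    have "[q - p + p = zstep a b k j + p] (mod N)" using that by (rule cong_add) simp
    then have "q mod N = (p + zstep a b k j) mod N" by (simp add: cong_def add.commute)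
    then show ?thesis
      unfolding mem_dcycle_zig by (intro exI[of _ p] exI[of _ j]) (simp add: assms(1))
  qed
  from assms(2) show ?thesis
  proof
    assume "\<epsilon> = 1"
    then show ?thesis using * assms(3) by auto
  next
    assume "\<epsilon> = - 1"
    then have "[x - y = zstep a b k j] (mod N)"
      using assms(3) cong_minus_minus_iff[of "x - y" "zstep a b k j" N] by simp
    then show ?thesis using * by (metis insert_commute)
  qed
qed

lemma zhalf_surj:
  assumes "0 < r" "r < int a * int b" "\<not> int a dvd r"
  obtains k j where "0 \<le> k" "k < int b" "Suc j < a" "zhalf a b k j = r"
proof -
  have a0: "int a > 0" using assms by (cases a) auto
  define j where "j = nat (r mod int a) - 1"
  define t where "t = r div int a"
  have "r mod int a > 0" 
    using assms(3) pos_mod_sign[OF a0, of r] by (simp add: dvd_eq_mod_eq_0)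
  then have j: "int j + 1 = r mod int a" unfolding j_def by linarith
  then have ja: "Suc j < a" using pos_mod_bound[OF a0, of r] by linarith
  have r: "r = int a * t + (int j + 1)" unfolding t_def j by simp
  have "int a * t < int a * int b" using r assms(2) by linarith
  then have "t < int b" using a0 by simp
  moreover have "0 \<le> t" using assms(1) a0 by (simp add: t_def pos_imp_zdiv_nonneg_iff)
  ultimately have t: "0 \<le> t" "t < int b" by simp_all
  \<comment> \<open>The reflection is its own inverse, so it is applied to the quotient
    \<open>t\<close> exactly when the remainder is \<open>a - 1\<close>.\<close>
  define k where "k = (if Suc (Suc j) = a then int b - 1 - t else t)"
  then have "zhalf a b k j = r" using r by (simp add: zhalf_def)
  moreover have "0 \<le> k" "k < int b" using t by (auto simp: k_def)
  ultimately show thesis using that ja by blast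
qed

text \<open>Modulo \<open>2 * a * b\<close>, either \<open>h\<close> or \<open>- h\<close> has its
  residue below \<open>a * b\<close>, where \<open>zhalf_surj\<close> applies; the sign is a matter
  of orientation.\<close>

lemma zig_cover_even:
  assumes "odd a" "y - x = 2 * h" "\<not> int a dvd h"
    and b: "b > 0"
  shows "\<exists>k u. 0 \<le> k \<and> k < int b \<and>
    {x mod (4 * (int a * int b)), y mod (4 * (int a * int b))} \<in> dcycle (4 * (int a * int b)) a (zig a b k u)"
proof -
  let ?P = "int a * int b"
  have P: "?P > 0" using b assms(1) by (simp add: odd_pos)
  have half: "\<exists>k u. 0 \<le> k \<and> k < int b \<and>
      {p mod (4 * ?P), q mod (4 * ?P)} \<in> dcycle (4 * ?P) a (zig a b k u)"
    if pq: "q - p = 2 * g" "\<not> int a dvd g" "g mod (2 * ?P) < ?P" for p q g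
  proof -
    have "int a dvd 2 * ?P" by simp
    then have na: "\<not> int a dvd g mod (2 * ?P)" using pq(2) by (simp add: dvd_mod_iff)
    then have "g mod (2 * ?P) \<noteq> 0" by (metis dvd_0_right)
    moreover have "0 \<le> g mod (2 * ?P)" using P by (intro pos_mod_sign) simp
    ultimately have "0 < g mod (2 * ?P)" by linarith
    then obtain k j where kj: "0 \<le> k" "k < int b" "Suc j < a" "zhalf a b k j = g mod (2 * ?P)"
      using zhalf_surj pq(3) na by blast
    define \<epsilon> :: int where "\<epsilon> = (if even j then 1 else - 1)"
    have "[zstep a b k j = \<epsilon> * (2 * (g mod (2 * ?P)))] (mod 4 * ?P)"
      using zstep_even[OF assms(1) kj(3), of b k] kj(4) by (simp add: \<epsilon>_def split: if_splits)
    then have "[\<epsilon> * zstep a b k j = \<epsilon> * (\<epsilon> * (2 * (g mod (2 * ?P))))] (mod 4 * ?P)"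
      by (rule cong_scalar_left)
    moreover have "\<epsilon> * (\<epsilon> * (2 * (g mod (2 * ?P)))) = 2 * (g mod (2 * ?P))"
      by (simp add: \<epsilon>_def)
    moreover have "[2 * (g mod (2 * ?P)) = q - p] (mod 4 * ?P)"
      unfolding pq(1) using mult_mod_right[of 2 g "2 * ?P"] by (simp add: cong_def)
    ultimately have "[q - p = \<epsilon> * zstep a b k j] (mod 4 * ?P)" by (metis cong_sym cong_trans)
    moreover have "\<epsilon> = 1 \<or> \<epsilon> = - 1" by (simp add: \<epsilon>_def)
    ultimately show ?thesis using zig_cover[of j a \<epsilon> q p b k] kj by auto
  qed
  show ?thesis
  proof (cases "h mod (2 * ?P) < ?P")
    case True
    then show ?thesis using half assms by blast
  next
    case False
    have "int a dvd 2 * ?P" by simp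
    then have na: "\<not> int a dvd h mod (2 * ?P)" using assms(3) by (simp add: dvd_mod_iff)
    \<comment> \<open>Both excluded residues are multiples of \<open>a\<close>; without them the
      residue of \<open>- h\<close> is strictly below \<open>?P\<close>, and exchanging
      \<open>x\<close> and \<open>y\<close> replaces \<open>h\<close> by \<open>- h\<close>.\<close>
    then have "h mod (2 * ?P) \<noteq> ?P" "h mod (2 * ?P) \<noteq> 0" by auto
    moreover have "(- h) mod (2 * ?P) = 2 * ?P - h mod (2 * ?P)"
      using calculation(2) by (simp add: zmod_zminus1_eq_if)
    ultimately have "(- h) mod (2 * ?P) < ?P" using False by linarith
    then show ?thesis using half[of x y "- h"] assms by (simp add: insert_commute)
  qed
qed

section \<open>The cycle system and its symmetries\<close>

text \<open>Letting \<open>s\<close> and \<open>u\<close> range over all integers makes closure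
  under translation immediate; parameters naming the same edge set are identified because this is a
  set.\<close>

definition cycle_family :: "nat \<Rightarrow> nat \<Rightarrow> int set set set" where
  "cycle_family a b =
     {dcycle (4 * (int a * int b)) 2 (alt s) | s. a = 1 \<or> \<not> int a dvd s} \<union>
     {dcycle (4 * (int a * int b)) a (zig a b k u) | k u. 1 < a \<and> 0 \<le> k \<and> k < int b}"

lemma cycle_family_cover_odd:
  assumes ab: "odd a" "odd b" and y: "y = x + (1 + 4 * s)"
  shows "{x mod (4 * (int a * int b)), y mod (4 * (int a * int b))} \<in> \<Union>(cycle_family a b)"
proof (cases "a = 1 \<or> \<not> int a dvd s")
  case True
  \<comment> \<open>The step at an even vertex uses \<open>s'\<close> and at an odd vertex
    \<open>- s'\<close>; this sign makes the step at \<open>x\<close> equal to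
    \<open>1 + 4 * s\<close>.\<close>
  define s' where "s' = (if even x then s else - s)"
  have "{x mod (4 * (int a * int b)), y mod (4 * (int a * int b))}
      \<in> dcycle (4 * (int a * int b)) 2 (alt s')"
    unfolding mem_dcycle_alt y s'_def by (intro exI[of _ x]) simp
  moreover have "a = 1 \<or> \<not> int a dvd s'" using True by (simp add: s'_def)
  ultimately show ?thesis unfolding cycle_family_def by blast
next
  case False
  then obtain t where t: "s = int a * t" by blast
  have a: "a > 1" using False ab(1) odd_pos[of a] by linarith
  have b: "int b > 0" using ab(2) by (simp add: odd_pos)
  define w where "w = (int b + 1) div 2"
  \<comment> \<open>This solves \<open>k + w = t\<close> modulo \<open>b\<close>, so that the
    closing step, traversed backwards, is \<open>1 + 4 * s\<close> modulo
    \<open>4 * a * b\<close>.\<close>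
  define k where "k = (t - w) mod int b"
  have k: "0 \<le> k" "k < int b" using b by (simp_all add: k_def)
  have "int b dvd k + w - t"
  proof -
    have "[k = t - w] (mod int b)" by (simp add: k_def)
    then show ?thesis by (simp add: cong_iff_dvd_diff algebra_simps)
  qed
  then obtain q where q: "k + w = t + int b * q" by (metis add_diff_cancel_left' diff_add_cancel dvdE add.commute)
  have "zstep a b k (a - 1) = - (1 + 4 * (int a * (t + int b * q)))"
    using zstep_odd[OF ab(2) _ a, of "a - 1" k] a q by (simp add: w_def)
  then have "y - x - - 1 * zstep a b k (a - 1) = (4 * (int a * int b)) * - q"
    by (simp add: y t algebra_simps)
  then have "[y - x = - 1 * zstep a b k (a - 1)] (mod 4 * (int a * int b))"
    unfolding cong_iff_dvd_diff by (metis dvd_triv_left)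
  then obtain u where "{x mod (4 * (int a * int b)), y mod (4 * (int a * int b))}
      \<in> dcycle (4 * (int a * int b)) a (zig a b k u)"
    using zig_cover[of "a - 1" a "- 1" y x b k] a by auto
  then show ?thesis unfolding cycle_family_def using a k by blast
qed

lemma cycle_family_cover:
  assumes ab: "odd a" "odd b" and xy: "\<not> 2 * int a dvd y - x"
  shows "{x mod (4 * (int a * int b)), y mod (4 * (int a * int b))} \<in> \<Union>(cycle_family a b)"
proof -
  \<comment> \<open>The difference is even, 1 modulo 4 or 3 modulo 4; the last case becomes the
    second when the edge is reversed.\<close>
  consider h where "y - x = 2 * h" | s where "y = x + (1 + 4 * s)" | s where "x = y + (1 + 4 * s)"
  proof -
    have "(\<exists>h. y - x = 2 * h) \<or> (\<exists>s. y = x + (1 + 4 * s)) \<or> (\<exists>s. x = y + (1 + 4 * s))"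
      by presburger
    then show thesis using that by blast
  qed
  then show ?thesis
  proof cases
    case 1
    then have h: "\<not> int a dvd h" using xy by auto
    then have "a > 1" using ab(1) odd_pos[of a] by (cases "a = 1") auto
    then show ?thesis
      using zig_cover_even[OF ab(1) 1 h odd_pos[OF ab(2)]] unfolding cycle_family_def by blast
  next
    case 2
    then show ?thesis by (rule cycle_family_cover_odd[OF ab])
  next
    case 3
    then show ?thesis using cycle_family_cover_odd[OF ab 3] by (simp add: insert_commute)
  qed
qed

text \<open>No step is divisible by \<open>2 * a\<close>: the odd ones by parity, the even ones
  because \<open>zhalf\<close> is never divisible by \<open>a\<close>.\<close>

lemma cycle_family_subset:
  assumes ab: "odd a" "odd b" and C: "C \<in> cycle_family a b"
  shows "C \<subseteq> Kmult_edges (2 * a) (2 * b)"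
proof
  fix e assume e: "e \<in> C"
  have N: "int (2 * a * (2 * b)) = 4 * (int a * int b)" by simp
  have pos: "2 * a > 0" "2 * b > 0" using ab by (simp_all add: odd_pos)
  have edge: "{v mod (4 * (int a * int b)), (v + d) mod (4 * (int a * int b))}
      \<in> Kmult_edges (2 * a) (2 * b)" if "\<not> 2 * int a dvd d" for v d
    using Kmult_edges_iff[OF pos, of v "v + d"] that unfolding N by simp
  consider s where "C = dcycle (4 * (int a * int b)) 2 (alt s)"
    | k u where "C = dcycle (4 * (int a * int b)) a (zig a b k u)" "1 < a" "0 \<le> k" "k < int b"
    using C unfolding cycle_family_def by blast
  then show "e \<in> Kmult_edges (2 * a) (2 * b)"
  proof cases
    case 1
    then obtain v where v: "e = {v mod (4 * (int a * int b)),
        (v + (1 + 4 * (if even v then s else - s))) mod (4 * (int a * int b))}"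
      using e unfolding 1 mem_dcycle_alt by blast
    have "odd (1 + 4 * (if even v then s else - s))" by simp
    then have "\<not> 2 * int a dvd 1 + 4 * (if even v then s else - s)" using dvd_mult_left by blast
    then show ?thesis unfolding v by (rule edge)
  next
    case 2
    then obtain v j where v: "j < a" "e = {v mod (4 * (int a * int b)),
        (v + zstep a b k j) mod (4 * (int a * int b))}"
      using e unfolding 2 mem_dcycle_zig by blast
    have "\<not> 2 * int a dvd zstep a b k j"
    proof (cases "Suc j < a")
      case True
      show ?thesis
      proof
        assume "2 * int a dvd zstep a b k j"
        moreover have "2 * int a dvd 4 * (int a * int b)" by (intro dvdI[of _ _ "2 * int b"]) simp
        ultimately have "2 * int a dvd (if even j then 2 else - 2) * zhalf a b k j"
          using zstep_even[OF ab(1) True, of b k] by (metis cong_dvd_iff cong_dvd_modulus)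
        then have "2 * int a dvd 2 * zhalf a b k j" by (auto split: if_splits)
        then have "int a dvd zhalf a b k j" by simp
        then show False using zhalf_bounds[OF 2(3,4) True] by simp
      qed
    next
      case False
      then have "odd (zstep a b k j)" using zstep_parity[OF ab 2(2) v(1)] by simp
      then show ?thesis using dvd_mult_left by blast
    qed
    then show ?thesis unfolding v(2) by (rule edge)
  qed
qed

lemma cycle_family_disjoint:
  assumes ab: "odd a" "odd b" and C: "C \<in> cycle_family a b" "C' \<in> cycle_family a b"
    and e: "e \<in> C" "e \<in> C'"
  shows "C = C'"
proof -
  have 1: "C = C'" if "C = dcycle (4 * (int a * int b)) 2 (alt s)"
    "C' = dcycle (4 * (int a * int b)) 2 (alt s')" for s s'
    using alt_unique e that by blast
  have 2: False if "C = dcycle (4 * (int a * int b)) 2 (alt s)" "a = 1 \<or> \<not> int a dvd s"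
    "C' = dcycle (4 * (int a * int b)) a (zig a b k u)" "1 < a" "e \<in> C" "e \<in> C'" for C C' s k u
    using alt_zig_disjoint[OF ab that(4) _ refl] that by auto
  have 3: "C = C'" if "C = dcycle (4 * (int a * int b)) a (zig a b k u)" "0 \<le> k" "k < int b"
    "C' = dcycle (4 * (int a * int b)) a (zig a b k' u')" "0 \<le> k'" "k' < int b" "1 < a" for k u k' u'
    using zig_unique[OF ab that(7,2,3,5,6) refl] that e by blast
  show ?thesis using C 1 2 3 e unfolding cycle_family_def by blast
qed

lemma cycle_family_hamiltonian:
  assumes ab: "odd a" "odd b" and C: "C \<in> cycle_family a b"
  shows "hamiltonian_cycle (Kmult_verts (2 * a) (2 * b)) (Kmult_edges (2 * a) (2 * b)) C"
proof -
  have pos: "a > 0" "b > 0" using ab by (simp_all add: odd_pos)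
  \<comment> \<open>The vertex number is written as \<open>l * L\<close> with \<open>l = 2\<close>
    and with \<open>l = a\<close>.\<close>
  have N: "2 * a * (2 * b) = 2 * (2 * a * b)" "2 * a * (2 * b) = a * (4 * b)"
    "4 * (int a * int b) = int (2 * a * (2 * b))" by simp_all
  have "\<exists>xs. length xs \<ge> 3 \<and> distinct xs \<and> set xs = Zmod (2 * a * (2 * b)) \<and> C = cycle_edges xs"
  proof -
    have "2 * a * b > 1" using pos by (simp add: Suc_lessI)
    note alt = dcycle_alt_hamiltonian[OF this, folded N(1), folded N(3)]
    have "4 * b > 2" using pos by simp
    note zig = dcycle_zig_hamiltonian[OF ab(1) _ this, folded N(2), folded N(3)]
    show ?thesis using C alt zig unfolding cycle_family_def by blast
  qed
  then show ?thesis
    using cycle_family_subset[OF ab C] unfolding hamiltonian_cycle_def Kmult_verts_def by blast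
qed

lemma cycle_family_partition:
  assumes ab: "odd a" "odd b"
  shows "partition_on (Kmult_edges (2 * a) (2 * b)) (cycle_family a b)"
proof (rule partition_onI)
  have pos: "2 * a > 0" "2 * b > 0" using ab by (simp_all add: odd_pos)
  have N: "int (2 * a * (2 * b)) = 4 * (int a * int b)" by simp
  show "\<Union>(cycle_family a b) = Kmult_edges (2 * a) (2 * b)"
  proof (intro equalityI subsetI)
    fix e assume "e \<in> Kmult_edges (2 * a) (2 * b)"
    moreover from this obtain x y where xy: "e = {x, y}"
      "x \<in> Zmod (2 * a * (2 * b))" "y \<in> Zmod (2 * a * (2 * b))"
      unfolding Kmult_edges_def by blast
    then have e: "e = {x mod int (2 * a * (2 * b)), y mod int (2 * a * (2 * b))}"
      by (simp add: Zmod_def)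
    ultimately have "\<not> 2 * int a dvd y - x" using Kmult_edges_iff[OF pos] by simp
    then show "e \<in> \<Union>(cycle_family a b)" unfolding e N by (rule cycle_family_cover[OF ab])
  qed (use cycle_family_subset[OF ab] in blast)
  show "disjnt C C'" if "C \<in> cycle_family a b" "C' \<in> cycle_family a b" "C \<noteq> C'" for C C'
    using cycle_family_disjoint[OF ab that(1,2)] that(3) unfolding disjnt_def by blast
  have "C \<noteq> {}" if C: "C \<in> cycle_family a b" for C
  proof -
    obtain l c where "C = dcycle (4 * (int a * int b)) l c" "l > 0"
      using C pos unfolding cycle_family_def by fastforce
    then show ?thesis by (simp add: dcycle_nonempty)
  qed
  then show "{} \<notin> cycle_family a b" by blast
qed

text \<open>Translation by 1 sends \<open>s\<close> to \<open>- s\<close> and \<open>u\<close> to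
  \<open>u + 1\<close>; both respect the conditions on the parameters.\<close>

lemma cycle_family_cyclic: "cyclic_system (2 * a) (2 * b) (cycle_family a b)"
  unfolding cyclic_system_def
proof
  fix C assume C: "C \<in> cycle_family a b"
  have N: "4 * (int a * int b) = int (2 * a * (2 * b))" by simp
  have "map_edges (shift (2 * a * (2 * b)) 1) (dcycle (4 * (int a * int b)) 2 (alt s))
      = dcycle (4 * (int a * int b)) 2 (alt (- s))" for s
    unfolding N map_edges_shift_dcycle using dcycle_alt_add_1 by simp
  moreover have "map_edges (shift (2 * a * (2 * b)) 1) (dcycle (4 * (int a * int b)) a (zig a b k u))
      = dcycle (4 * (int a * int b)) a (zig a b k (u + 1))" for k u
  proof -
    have "(\<lambda>j. zig a b k u j + int 1) = zig a b k (u + 1)" by (auto simp: zig_def)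
    then show ?thesis unfolding N map_edges_shift_dcycle by simp
  qed
  moreover have "int a dvd - s \<longleftrightarrow> int a dvd s" for s by simp
  ultimately show "map_edges (shift (2 * a * (2 * b)) 1) C \<in> cycle_family a b"
    using C unfolding cycle_family_def by fastforce
qed

text \<open>Both periods, 2 and \<open>a\<close>, divide \<open>2 * a\<close>, so translation by
  \<open>2 * a\<close> preserves the classes of initial vertices.\<close>

lemma cycle_family_symmetric: "phi_symmetric (2 * a) (2 * b) (cycle_family a b)"
  unfolding phi_symmetric_def phi_def
proof
  fix C assume C: "C \<in> cycle_family a b"
  have N: "4 * (int a * int b) = int (2 * a * (2 * b))" by simp
  have *: "map_edges (shift (2 * a * (2 * b)) (2 * a)) (dcycle (4 * (int a * int b)) l c)
      = dcycle (4 * (int a * int b)) l c" if "l dvd 2 * a" for l c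
  proof -
    have "int l dvd int (2 * a)" using that int_dvd_int_iff by blast
    then show ?thesis
      unfolding N map_edges_shift_dcycle by (intro dcycle_cong) (auto simp: cong_iff_dvd_diff)
  qed
  show "map_edges (shift (2 * a * (2 * b)) (2 * a)) C = C"
    using C *[of 2] *[of a] unfolding cycle_family_def by fastforce
qed

theorem theorem4p9:
  fixes m n :: nat
  assumes "m > 0" and "n > 0"
    and "[m = 2] (mod 4)" and "[n = 2] (mod 4)"
  shows "\<exists>\<C>. HCS_Kmult m n \<C> \<and> cyclic_system m n \<C> \<and> phi_symmetric m n \<C>"
proof -
  have half: "\<exists>a. odd a \<and> p = 2 * a" if "[p = 2] (mod 4)" for p :: nat
    using that unfolding cong_def by presburger
  obtain a b where ab: "odd a" "odd b" and mn: "m = 2 * a" "n = 2 * b"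
    using half assms(3,4) by blast
  have "HCS_Kmult m n (cycle_family a b)"
    unfolding HCS_Kmult_def hamiltonian_cycle_system_def mn
    using cycle_family_hamiltonian[OF ab] cycle_family_partition[OF ab] by simp
  then show ?thesis unfolding mn using cycle_family_cyclic cycle_family_symmetric by blast
qed

end
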